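(* Let $(X,\kappa)$ be a connected involutive digital image, with its $\kappa$-continuous free involution written $x\mapsto -x$, and let $f:(X,\kappa)\to(\mathbb{Z},c_1)$ have Lipschitz constant $m>0$. Then there is a point $x\in X$ such that $|f(x)-f(-x)|<2m$.
   Context: A digital image is a pair $(X,\kappa)$ where $X$ is a set and $\kappa$ is a symmetric antireflexive relation on $X$ (the adjacency relation); write $a\leftrightarrow_\kappa b$ when $a,b$ are $\kappa$-adjacent. On $\mathbb{Z}$, the adjacency $c_1$ is given by: $a,b$ are $c_1$-adjacent iff $|a-b|=1$. A function $f:(X,\kappa)\to(Y,\lambda)$ between digital images is $(\kappa,\lambda)$-continuous if $a\leftrightarrow_\kappa b$ implies that $f(a)$ and $f(b)$ are $\lambda$-adjacent or equal; for a self-map of $(X,\kappa)$, $\kappa$-continuous means $(\kappa,\kappa)$-continuous. A $\kappa$-path of length $n$ from $a$ to $b$ in $X$ is a $(c_1,\kappa)$-continuous function $p:\{0,1,\dots,n\}\to X$ with $p(0)=a$, $p(n)=b$ (consecutive points may be equal). $(X,\kappa)$ is connected if any two points of $X$ are joined by a $\kappa$-path. An involution is a continuous map $\tau:X\to X$ with $\tau(\tau(x))=x$ for all $x\in X$; it is a free involution if it has no fixed points. A digital image is involutive if it admits a $\kappa$-continuous free involution $\tau$, and one writes $\tau(x)=-x$. For an integer $m$, a function $f:(X,\kappa)\to(Y,\lambda)$ has Lipschitz constant $m$ if $a\leftrightarrow_\kappa b$ implies there is a $\lambda$-path of length $m$ from $f(a)$ to $f(b)$; for $f:(X,\kappa)\to(\mathbb{Z},c_1)$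 this means that $|f(a)-f(b)|\le m$ whenever $a$ and $b$ are $\kappa$-adjacent or equal. *)

theory Defs
  imports Main
begin

definition digital_image :: "'a set \<Rightarrow> 'a rel \<Rightarrow> bool" where
  "digital_image X \<kappa> \<longleftrightarrow> \<kappa> \<subseteq> X \<times> X \<and> sym \<kappa> \<and> irrefl \<kappa>"

text \<open>The adjacency on all of the integers; a subset \<open>S\<close> of the integers carries
  the adjacency \<open>Restr c1 S\<close>.\<close>

definition c1 :: "int rel" where
  "c1 = {(a, b). \<bar>a - b\<bar> = 1}"

text \<open>Functions between images are total functions of the ambient types; only their values on
  the domain \<open>X\<close> are constrained.\<close>

definition digitally_continuous ::
    "'a set \<Rightarrow> 'a rel \<Rightarrow> 'b set \<Rightarrow> 'b rel \<Rightarrow> ('a \<Rightarrow> 'b) \<Rightarrow> bool" where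
  "digitally_continuous X \<kappa> Y \<mu> f \<longleftrightarrow>
     f ` X \<subseteq> Y \<and> (\<forall>a\<in>X. \<forall>b\<in>X. (a, b) \<in> \<kappa> \<longrightarrow> (f a, f b) \<in> \<mu> \<or> f a = f b)"

text \<open>The length is an integer so that it can be compared with a Lipschitz constant; there are
  no paths of negative length.\<close>

definition digital_path ::
    "'a set \<Rightarrow> 'a rel \<Rightarrow> int \<Rightarrow> 'a \<Rightarrow> 'a \<Rightarrow> (int \<Rightarrow> 'a) \<Rightarrow> bool" where
  "digital_path X \<kappa> n a b p \<longleftrightarrow>
     0 \<le> n \<and> digitally_continuous {0..n} (Restr c1 {0..n}) X \<kappa> p \<and> p 0 = a \<and> p n = b"

definition digitally_connected :: "'a set \<Rightarrow> 'a rel \<Rightarrow> bool" where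
  "digitally_connected X \<kappa> \<longleftrightarrow> (\<forall>a\<in>X. \<forall>b\<in>X. \<exists>n p. digital_path X \<kappa> n a b p)"

definition digital_involution :: "'a set \<Rightarrow> 'a rel \<Rightarrow> ('a \<Rightarrow> 'a) \<Rightarrow> bool" where
  "digital_involution X \<kappa> \<tau> \<longleftrightarrow>
     digitally_continuous X \<kappa> X \<kappa> \<tau> \<and> (\<forall>x\<in>X. \<tau> (\<tau> x) = x)"

definition free_involution :: "'a set \<Rightarrow> 'a rel \<Rightarrow> ('a \<Rightarrow> 'a) \<Rightarrow> bool" where
  "free_involution X \<kappa> \<tau> \<longleftrightarrow> digital_involution X \<kappa> \<tau> \<and> (\<forall>x\<in>X. \<tau> x \<noteq> x)"

definition has_lipschitz_constant ::
    "'a set \<Rightarrow> 'a rel \<Rightarrow> 'b set \<Rightarrow> 'b rel \<Rightarrow> ('a \<Rightarrow> 'b) \<Rightarrow> int \<Rightarrow> bool" where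
  "has_lipschitz_constant X \<kappa> Y \<mu> f m \<longleftrightarrow>
     f ` X \<subseteq> Y \<and>
     (\<forall>a\<in>X. \<forall>b\<in>X. (a, b) \<in> \<kappa> \<longrightarrow> (\<exists>p. digital_path Y \<mu> m (f a) (f b) p))"

lemma digital_image_c1: "digital_image UNIV c1"
  by (auto simp: digital_image_def c1_def sym_def irrefl_def)

lemma digital_path_c1_iff:
  "(\<exists>p. digital_path UNIV c1 m a b p) \<longleftrightarrow> \<bar>a - b\<bar> \<le> m"
proof
  assume "\<exists>p. digital_path UNIV c1 m a b p"
  then obtain p where m: "0 \<le> m" and p: "p 0 = a" "p m = b"
    and cont: "digitally_continuous {0..m} (Restr c1 {0..m}) UNIV c1 p"
    by (auto simp: digital_path_def)
  have "k \<le> m \<longrightarrow> \<bar>p 0 - p k\<bar> \<le> k" if "0 \<le> k" for k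
    using that
  proof (induction k rule: int_ge_induct)
    case base
    show ?case by simp
  next
    case (step i)
    have "\<bar>p i - p (i + 1)\<bar> \<le> 1" if "i + 1 \<le> m"
    proof -
      have "(p i, p (i + 1)) \<in> c1 \<or> p i = p (i + 1)"
        using cont step.hyps that by (auto simp: digitally_continuous_def c1_def)
      then show ?thesis by (auto simp: c1_def)
    qed
    with step.IH show ?case by linarith
  qed
  from this[OF m] p show "\<bar>a - b\<bar> \<le> m" by simp
next
  assume le: "\<bar>a - b\<bar> \<le> m"
  define p where "p k = (if a \<le> b then min (a + k) b else max (a - k) b)" for k
  have "digital_path UNIV c1 m a b p"
    unfolding digital_path_def digitally_continuous_def c1_def p_def
    using le by (auto simp: min_def max_def abs_if split: if_splits)
  then show "\<exists>p. digital_path UNIV c1 m a b p"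
    by blast
qed

text \<open>For \<open>m \<ge> 0\<close> the case \<open>a = b\<close> is trivial, so adjacent points suffice.\<close>

lemma has_lipschitz_constant_int_iff:
  "has_lipschitz_constant X \<kappa> UNIV c1 f m \<longleftrightarrow>
     (\<forall>a\<in>X. \<forall>b\<in>X. (a, b) \<in> \<kappa> \<longrightarrow> \<bar>f a - f b\<bar> \<le> m)"
  by (simp add: has_lipschitz_constant_def digital_path_c1_iff)

end

theory Submission
  imports Defs
begin

text \<open>The proof is a discrete intermediate value argument for the odd function
  \<open>g x = f x - f (\<tau> x)\<close>. Since \<open>\<tau>\<close> is continuous, it moves adjacent points to adjacent or equal
  points, so both summands of \<open>g\<close> vary by at most \<open>m\<close> across an adjacency and \<open>g\<close> varies by at
  most \<open>2 * m\<close>. If \<open>\<bar>g\<bar> \<ge> 2 * m\<close> held everywhere, a sign change between neighbours would be a jump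
  of at least \<open>4 * m > 2 * m\<close>; so \<open>g\<close> would have the same sign all along a path, and by connectedness on
  all of \<open>X\<close>. But \<open>g (\<tau> x) = - g x\<close>.\<close>

text \<open>This induction principle is the only form in which connectedness is used: a subset closed
  under passing to neighbours absorbs every path that starts in it.\<close>

lemma digitally_connected_induct:
  assumes conn: "digitally_connected X \<kappa>"
    and X: "a \<in> X" "b \<in> X" and "P a"
    and step: "\<And>x y. \<lbrakk>x \<in> X; y \<in> X; (x, y) \<in> \<kappa>; P x\<rbrakk> \<Longrightarrow> P y"
  shows "P b"
proof -
  obtain n p where n: "0 \<le> n" and p: "p 0 = a" "p n = b"
    and cont: "digitally_continuous {0..n} (Restr c1 {0..n}) X \<kappa> p"
    using conn X unfolding digitally_connected_def digital_path_def by meson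
  have "k \<le> n \<longrightarrow> P (p k)" if "0 \<le> k" for k
    using that
  proof (induction k rule: int_ge_induct)
    case base
    show ?case using p \<open>P a\<close> by simp
  next
    case (step i)
    show ?case
    proof
      assume le: "i + 1 \<le> n"
      have "(p i, p (i + 1)) \<in> \<kappa> \<or> p i = p (i + 1)"
        using cont step.hyps le by (auto simp: digitally_continuous_def c1_def)
      moreover have "p i \<in> X" "p (i + 1) \<in> X"
        using cont step.hyps le by (auto simp: digitally_continuous_def)
      moreover have "P (p i)" using step.IH le by simp
      ultimately show "P (p (i + 1))" using assms(5) by metis
    qed
  qed
  from this[OF n] p show ?thesis by simp
qed

lemma lipschitz_antipodal_difference:
  assumes \<tau>: "digitally_continuous X \<kappa> X \<kappa> \<tau>"
    and f: "has_lipschitz_constant X \<kappa> UNIV c1 f m"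
    and xy: "x \<in> X" "y \<in> X" "(x, y) \<in> \<kappa>"
  shows "\<bar>(f x - f (\<tau> x)) - (f y - f (\<tau> y))\<bar> \<le> 2 * m"
proof -
  have "\<tau> x \<in> X" "\<tau> y \<in> X" "(\<tau> x, \<tau> y) \<in> \<kappa> \<or> \<tau> x = \<tau> y"
    using \<tau> xy by (auto simp: digitally_continuous_def)
  moreover have le: "\<bar>f x - f y\<bar> \<le> m"
    using f xy unfolding has_lipschitz_constant_int_iff by blast
  \<comment> \<open>If \<open>\<tau> x = \<tau> y\<close>, the Lipschitz condition need not apply to the images, and the bound
    \<open>0 \<le> m\<close> comes from the adjacent pair \<open>x\<close>, \<open>y\<close>.\<close>
  ultimately have "\<bar>f (\<tau> x) - f (\<tau> y)\<bar> \<le> m"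
    using f unfolding has_lipschitz_constant_int_iff by fastforce
  with le show ?thesis by linarith
qed

theorem theorem3p3:
  fixes X :: "'a set" and \<kappa> :: "'a rel" and \<tau> :: "'a \<Rightarrow> 'a"
    and f :: "'a \<Rightarrow> int" and m :: int
  assumes "digital_image X \<kappa>"
    and "X \<noteq> {}"
    and "digitally_connected X \<kappa>"
    and "free_involution X \<kappa> \<tau>"
    and "has_lipschitz_constant X \<kappa> UNIV c1 f m"
    and "m > 0"
  shows "\<exists>x\<in>X. \<bar>f x - f (\<tau> x)\<bar> < 2 * m"
proof (rule ccontr)
  assume "\<not> ?thesis"
  then have large: "2 * m \<le> \<bar>f x - f (\<tau> x)\<bar>" if "x \<in> X" for x
    using that by force
  have cont: "digitally_continuous X \<kappa> X \<kappa> \<tau>" and inv: "\<And>x. x \<in> X \<Longrightarrow> \<tau> (\<tau> x) = x"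
    using assms(4) by (auto simp: free_involution_def digital_involution_def)
  have X: "\<tau> x \<in> X" if "x \<in> X" for x
    using cont that by (auto simp: digitally_continuous_def)
  obtain z where "z \<in> X" using assms(2) by blast
  \<comment> \<open>One of \<open>z\<close> and its antipode is a starting point at which the difference is nonnegative.\<close>
  then obtain a where a: "a \<in> X" "0 \<le> f a - f (\<tau> a)"
    using X[of z] inv[of z] by (metis diff_ge_0_iff_ge linear)
  have "0 \<le> f (\<tau> a) - f (\<tau> (\<tau> a))"
  proof (rule digitally_connected_induct[OF assms(3) a(1) X[OF a(1)],
        where P = "\<lambda>x. 0 \<le> f x - f (\<tau> x)"])
    show "0 \<le> f a - f (\<tau> a)" by (rule a(2))
  next
    fix x y
    assume xy: "x \<in> X" "y \<in> X" "(x, y) \<in> \<kappa>" and "0 \<le> f x - f (\<tau> x)"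
    moreover have "\<bar>(f x - f (\<tau> x)) - (f y - f (\<tau> y))\<bar> \<le> 2 * m"
      by (rule lipschitz_antipodal_difference[OF cont assms(5) xy])
    ultimately show "0 \<le> f y - f (\<tau> y)"
      using large[OF xy(1)] by linarith
  qed
  then show False
    using a inv[OF a(1)] large[OF a(1)] assms(6) by simp
qed

end
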